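(* Let $X:\Omega\to\mathbb{R}^d$, $d\ge1$, and $S:\Omega\to\{0,1\}$ be random variables on a common probability space $(\Omega,\mathcal{B},\mathbb{P})$, and let $\mathcal{G}$ be a family of binary classifiers $g:\mathbb{R}^d\to\{0,1\}$. Then $$\min_{g\in\mathcal{G}}BER(g,X,S)=\frac12\Big(1-d_{TV}\big(\mathcal{L}(X\mid S=0),\mathcal{L}(X\mid S=1)\big)\Big).$$
   Context: $\mathcal{G}$ is introduced only as a family of binary classifiers $g:\mathbb{R}^d\to\{0,1\}$, used to form predictions $g(X)$; by a standing convention, the classifiers considered satisfy $\mathbb{P}(g(X)=1\mid S=0)>0$ and $\mathbb{P}(g(X)=1\mid S=1)>0$. The Balanced Error Rate of $g\in\mathcal{G}$ with respect to the joint distribution of $(X,S)$ is $$BER(g,X,S)=\frac{\mathbb{P}(g(X)=0\mid S=1)+\mathbb{P}(g(X)=1\mid S=0)}{2}.$$ $\mathcal{L}(X\mid S=s)$ denotes the conditional distribution of $X$ given $S=s$, for $s\in\{0,1\}$. The total variation distance is normalized to take values in $[0,1]$: if $P$ and $Q$ have densities $f_0,f_1$ with respect to a common dominating measure $\mu$, then $d_{TV}(P,Q)=\frac12\int|f_0-f_1|\,d\mu$.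
   Formalization: The family G is taken to be all Borel classifiers, without the convention P(g(X)=1|S=s)>0, since the identity fails for arbitrary G (e.g. only the constant 1) and under that convention (X=S); P(S=0)>0 and P(S=1)>0 are assumed so that the conditional laws exist. *)

theory Defs
  imports "HOL-Probability.Probability"
begin

text \<open>
  The family of classifiers over which the minimum is taken consists of all Borel measurable
  maps into \<open>{0,1}\<close>; the range condition is part of measurability into \<open>count_space {0, 1}\<close>.
  For smaller families the identity can fail, and it does fail in general if every classifier is
  required to satisfy \<open>P(g(X) = 1 | S = s) > 0\<close>: for \<open>X = S\<close> this forces \<open>g = 1\<close> on \<open>{0,1}\<close>,
  so the error rate is \<open>1/2\<close> while the conditional laws have total variation distance \<open>1\<close>.
\<close>

definition binary_classifiers :: "(real ^ 'd \<Rightarrow> nat) set" where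
  "binary_classifiers = borel \<rightarrow>\<^sub>M count_space {0, 1}"

definition BER :: "'w measure \<Rightarrow> ('x \<Rightarrow> nat) \<Rightarrow> ('w \<Rightarrow> 'x) \<Rightarrow> ('w \<Rightarrow> nat) \<Rightarrow> real" where
  "BER M g X S =
     (\<P>(\<omega> in M. g (X \<omega>) = 0 \<bar> S \<omega> = 1) + \<P>(\<omega> in M. g (X \<omega>) = 1 \<bar> S \<omega> = 0)) / 2"

text \<open>
  The conditional law of \<open>X\<close> given \<open>S = s\<close>. It is only meaningful when \<open>S = s\<close> has positive
  probability.
\<close>

definition cond_law ::
  "'w measure \<Rightarrow> ('w \<Rightarrow> 'x::topological_space) \<Rightarrow> ('w \<Rightarrow> nat) \<Rightarrow> nat \<Rightarrow> 'x measure" where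
  "cond_law M X S s = distr (uniform_measure M {\<omega> \<in> space M. S \<omega> = s}) borel X"

definition common_densities ::
  "'x measure \<Rightarrow> 'x measure \<Rightarrow> 'x measure \<Rightarrow> ('x \<Rightarrow> real) \<Rightarrow> ('x \<Rightarrow> real) \<Rightarrow> bool" where
  "common_densities P Q \<mu> f\<^sub>0 f\<^sub>1 \<longleftrightarrow>
     f\<^sub>0 \<in> borel_measurable \<mu> \<and> f\<^sub>1 \<in> borel_measurable \<mu> \<and>
     (\<forall>x. 0 \<le> f\<^sub>0 x) \<and> (\<forall>x. 0 \<le> f\<^sub>1 x) \<and>
     P = density \<mu> f\<^sub>0 \<and> Q = density \<mu> f\<^sub>1"

text \<open>
  The description below determines a unique number for probability measures \<open>P\<close> and \<open>Q\<close> on the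
  same sigma-algebra: independence of the dominating measure and of the densities is
  \<open>tv_dist_eq\<close>, and a dominating measure always exists, e.g. \<open>(P + Q) / 2\<close>.
\<close>

definition tv_dist :: "'x measure \<Rightarrow> 'x measure \<Rightarrow> real" where
  "tv_dist P Q =
     (THE t. \<exists>\<mu> f\<^sub>0 f\<^sub>1. common_densities P Q \<mu> f\<^sub>0 f\<^sub>1 \<and> t = (\<integral>x. \<bar>f\<^sub>0 x - f\<^sub>1 x\<bar> \<partial>\<mu>) / 2)"

lemma density_integral_eq_measure:
  fixes f :: "'x \<Rightarrow> real"
  assumes P: "prob_space P" and f: "f \<in> borel_measurable \<mu>" "\<And>x. 0 \<le> f x"
    and eq: "P = density \<mu> f" and A: "A \<in> sets \<mu>"
  shows "integrable \<mu> (\<lambda>x. indicator A x * f x)"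
    and "(\<integral>x. indicator A x * f x \<partial>\<mu>) = measure P A"
proof -
  interpret P: prob_space P by fact
  have e: "(\<integral>\<^sup>+x. ennreal (indicator A x * f x) \<partial>\<mu>) = emeasure P A"
    unfolding eq using f A
    by (auto simp: emeasure_density intro!: nn_integral_cong split: split_indicator)
  show int: "integrable \<mu> (\<lambda>x. indicator A x * f x)"
  proof (rule integrableI_nonneg)
    show "(\<integral>\<^sup>+x. ennreal (indicator A x * f x) \<partial>\<mu>) < \<infinity>"
      unfolding e using P.emeasure_finite[of A] by (simp add: less_top[symmetric])
  qed (use f A in auto)
  have "ennreal (\<integral>x. indicator A x * f x \<partial>\<mu>) = emeasure P A"
    using nn_integral_eq_integral[OF int] f e by simp
  then show "(\<integral>x. indicator A x * f x \<partial>\<mu>) = measure P A"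
    using f by (simp add: P.emeasure_eq_measure)
qed

lemma common_densities_tv:
  assumes P: "prob_space P" and Q: "prob_space Q"
    and cd: "common_densities P Q \<mu> f\<^sub>0 f\<^sub>1"
  shows "(\<integral>x. \<bar>f\<^sub>0 x - f\<^sub>1 x\<bar> \<partial>\<mu>) / 2 = (SUP A\<in>sets P. measure P A - measure Q A)"
proof -
  have f[measurable]: "f\<^sub>0 \<in> borel_measurable \<mu>" "f\<^sub>1 \<in> borel_measurable \<mu>"
    and nn: "\<And>x. 0 \<le> f\<^sub>0 x" "\<And>x. 0 \<le> f\<^sub>1 x"
    and PQ: "P = density \<mu> f\<^sub>0" "Q = density \<mu> f\<^sub>1"
    using cd by (auto simp: common_densities_def)
  have sets: "sets P = sets \<mu>" unfolding PQ by simp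
  note p = density_integral_eq_measure[OF P f(1) nn(1) PQ(1)]
  note q = density_integral_eq_measure[OF Q f(2) nn(2) PQ(2)]
  have diff: "integrable \<mu> (\<lambda>x. indicator A x * f\<^sub>0 x - indicator A x * f\<^sub>1 x)"
    "measure P A - measure Q A = (\<integral>x. indicator A x * f\<^sub>0 x - indicator A x * f\<^sub>1 x \<partial>\<mu>)"
    if "A \<in> sets \<mu>" for A
    using p[OF that] q[OF that] by auto
  define B where "B = {x \<in> space \<mu>. f\<^sub>1 x < f\<^sub>0 x}"
  have B: "B \<in> sets \<mu>" unfolding B_def by measurable
  have top: "space \<mu> \<in> sets \<mu>" by simp
  have one: "measure P (space \<mu>) = 1" "measure Q (space \<mu>) = 1"
    using prob_space.prob_space[OF P] prob_space.prob_space[OF Q] PQ by auto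
  have "(\<integral>x. \<bar>f\<^sub>0 x - f\<^sub>1 x\<bar> \<partial>\<mu>) =
      (\<integral>x. 2 * (indicator B x * f\<^sub>0 x - indicator B x * f\<^sub>1 x)
          - (indicator (space \<mu>) x * f\<^sub>0 x - indicator (space \<mu>) x * f\<^sub>1 x) \<partial>\<mu>)"
    by (intro Bochner_Integration.integral_cong) (auto simp: B_def split: split_indicator)
  also have "\<dots> = 2 * (measure P B - measure Q B)
      - (measure P (space \<mu>) - measure Q (space \<mu>))"
    unfolding diff(2)[OF B] diff(2)[OF top]
    using Bochner_Integration.integral_diff[OF integrable_mult_right[OF diff(1)[OF B], of 2]
        diff(1)[OF top]]
    by (simp only: integral_mult_right_zero)
  finally have eqB: "(\<integral>x. \<bar>f\<^sub>0 x - f\<^sub>1 x\<bar> \<partial>\<mu>) / 2 = measure P B - measure Q B"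
    using one by simp
  have le: "measure P A - measure Q A \<le> measure P B - measure Q B" if "A \<in> sets \<mu>" for A
    unfolding diff(2)[OF B] diff(2)[OF that]
    by (intro integral_mono diff(1) B that)
       (use nn in \<open>auto simp: B_def split: split_indicator dest: sets.sets_into_space[OF that, THEN subsetD]\<close>)
  show ?thesis
    unfolding eqB sets using B le by (intro cSup_eq_maximum[symmetric]) auto
qed

lemma tv_dist_eq:
  assumes "prob_space P" "prob_space Q" "common_densities P Q \<mu> f\<^sub>0 f\<^sub>1"
  shows "tv_dist P Q = (\<integral>x. \<bar>f\<^sub>0 x - f\<^sub>1 x\<bar> \<partial>\<mu>) / 2"
  unfolding tv_dist_def
proof (rule the_equality)
  show "\<exists>\<nu> g\<^sub>0 g\<^sub>1. common_densities P Q \<nu> g\<^sub>0 g\<^sub>1 \<and>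
      (\<integral>x. \<bar>f\<^sub>0 x - f\<^sub>1 x\<bar> \<partial>\<mu>) / 2 = (\<integral>x. \<bar>g\<^sub>0 x - g\<^sub>1 x\<bar> \<partial>\<nu>) / 2"
    by (rule exI[of _ \<mu>], rule exI[of _ f\<^sub>0], rule exI[of _ f\<^sub>1]) (simp add: assms(3))
next
  fix t
  assume "\<exists>\<nu> g\<^sub>0 g\<^sub>1. common_densities P Q \<nu> g\<^sub>0 g\<^sub>1 \<and> t = (\<integral>x. \<bar>g\<^sub>0 x - g\<^sub>1 x\<bar> \<partial>\<nu>) / 2"
  then obtain \<nu> g\<^sub>0 g\<^sub>1 where "common_densities P Q \<nu> g\<^sub>0 g\<^sub>1" "t = (\<integral>x. \<bar>g\<^sub>0 x - g\<^sub>1 x\<bar> \<partial>\<nu>) / 2"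
    by blast
  then show "t = (\<integral>x. \<bar>f\<^sub>0 x - f\<^sub>1 x\<bar> \<partial>\<mu>) / 2"
    using common_densities_tv[OF assms(1,2), of \<nu> g\<^sub>0 g\<^sub>1] common_densities_tv[OF assms]
    by (simp only:)
qed

end

theory Submission
  imports Defs
begin

text \<open>
  The classifier \<open>g\<close> with \<open>B = {g = 0}\<close> has error rate \<open>(1 - (P B - Q B)) / 2\<close>, where \<open>P\<close> and
  \<open>Q\<close> are the conditional laws given \<open>S = 0\<close> and \<open>S = 1\<close>. The total variation distance is the
  supremum of \<open>P B - Q B\<close>, and a Hahn decomposition of \<open>P - Q\<close> supplies a set attaining it. Both
  laws are dominated by the law of \<open>X\<close>, so common densities exist.
\<close>

lemma common_densities_exist:
  assumes "sigma_finite_measure \<mu>" "prob_space P" "prob_space Q"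
    and "absolutely_continuous \<mu> P" "absolutely_continuous \<mu> Q"
    and "sets P = sets \<mu>" "sets Q = sets \<mu>"
  shows "\<exists>f\<^sub>0 f\<^sub>1. common_densities P Q \<mu> f\<^sub>0 f\<^sub>1"
proof -
  interpret \<mu>: sigma_finite_measure \<mu> by fact
  \<comment> \<open>\<open>RN_deriv\<close> takes values in \<open>ennreal\<close>, whereas
    \<open>common_densities\<close> asks for real functions that are nonnegative everywhere. As
    \<open>N\<close> is finite, its derivative is finite almost everywhere, and a real version of it
    has the same density measure.\<close>
  have ex: "\<exists>f \<in> borel_measurable \<mu>. (\<forall>x. 0 \<le> f x) \<and> N = density \<mu> (\<lambda>x. ennreal (f x))"
    if N: "prob_space N" "absolutely_continuous \<mu> N" "sets N = sets \<mu>" for N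
  proof -
    obtain D where D: "D \<in> borel_measurable \<mu>" "AE x in \<mu>. RN_deriv \<mu> N x = ennreal (D x)"
      "\<And>x. 0 \<le> D x"
      using \<mu>.real_RN_deriv[OF _ N(2,3)] N(1) by (metis prob_space_def)
    have "N = density \<mu> (RN_deriv \<mu> N)"
      by (rule \<mu>.density_RN_deriv[OF N(2,3), symmetric])
    also have "\<dots> = density \<mu> (\<lambda>x. ennreal (D x))"
      using D by (intro density_cong) auto
    finally show ?thesis using D by blast
  qed
  show ?thesis
    using ex[OF assms(2,4,6)] ex[OF assms(3,5,7)] unfolding common_densities_def by blast
qed

text \<open>The densities serve only to identify \<open>tv_dist\<close> with a supremum over
  measurable sets. The positive set of a Hahn decomposition of \<open>P - Q\<close> attains that
  supremum.\<close>

lemma tv_dist_maximum: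
  assumes P: "prob_space P" and Q: "prob_space Q" and sets: "sets Q = sets P"
    and cd: "common_densities P Q \<mu> f\<^sub>0 f\<^sub>1"
  shows "\<exists>B\<in>sets P. measure P B - measure Q B = tv_dist P Q"
    and "A \<in> sets P \<Longrightarrow> measure P A - measure Q A \<le> tv_dist P Q"
proof -
  interpret P: prob_space P by fact
  interpret Q: prob_space Q by fact
  obtain Y where Y: "Y \<in> sets P"
    and pos: "\<And>A. A \<in> sets P \<Longrightarrow> A \<subseteq> Y \<Longrightarrow> emeasure Q A \<le> emeasure P A"
    and neg: "\<And>A. A \<in> sets P \<Longrightarrow> A \<inter> Y = {} \<Longrightarrow> emeasure P A \<le> emeasure Q A"
    using finite_unsigned_Hahn_decomposition[OF P.finite_measure_axioms Q.finite_measure_axioms sets]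
    by metis
  have le: "measure P A - measure Q A \<le> measure P Y - measure Q Y" if A: "A \<in> sets P" for A
  proof -
    \<comment> \<open>Passing from \<open>A\<close> to \<open>Y\<close> removes
      \<open>A - Y\<close>, where \<open>P\<close> is at most \<open>Q\<close>, and adds
      \<open>Y - A\<close>, where \<open>P\<close> is at least \<open>Q\<close>. The common part
      \<open>A \<inter> Y\<close> cancels.\<close>
    have split: "measure P A = measure P (A \<inter> Y) + measure P (A - Y)"
      "measure P Y = measure P (A \<inter> Y) + measure P (Y - A)"
      "measure Q A = measure Q (A \<inter> Y) + measure Q (A - Y)"
      "measure Q Y = measure Q (A \<inter> Y) + measure Q (Y - A)"
      using A Y sets P.finite_measure_Diff' [of A Y] P.finite_measure_Diff'[of Y A]
        Q.finite_measure_Diff'[of A Y] Q.finite_measure_Diff'[of Y A]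
      by (auto simp: Int_commute)
    have "measure Q (Y - A) \<le> measure P (Y - A)" "measure P (A - Y) \<le> measure Q (A - Y)"
      using pos[of "Y - A"] neg[of "A - Y"] A Y
      by (auto simp: P.emeasure_eq_measure Q.emeasure_eq_measure)
    then show ?thesis using split by linarith
  qed
  have "tv_dist P Q = (SUP A\<in>sets P. measure P A - measure Q A)"
    using tv_dist_eq[OF P Q cd] common_densities_tv[OF P Q cd] by simp
  also have "\<dots> = measure P Y - measure Q Y"
    using Y le by (intro cSup_eq_maximum) auto
  finally have tv: "tv_dist P Q = measure P Y - measure Q Y" .
  show "\<exists>B\<in>sets P. measure P B - measure Q B = tv_dist P Q"
    using Y tv by auto
  show "measure P A - measure Q A \<le> tv_dist P Q" if "A \<in> sets P"
    using le[OF that] tv by simp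
qed

lemma sets_cond_law [simp]: "sets (cond_law M X S s) = sets borel"
  by (simp add: cond_law_def)

lemma prob_space_cond_law:
  assumes "prob_space M" "X \<in> borel_measurable M" "\<P>(\<omega> in M. S \<omega> = s) > 0"
  shows "prob_space (cond_law M X S s)"
proof -
  interpret prob_space M by fact
  show ?thesis
    unfolding cond_law_def using assms
    by (intro prob_space.prob_space_distr prob_space_uniform_measure)
       (auto simp: emeasure_eq_measure)
qed

lemma measure_cond_law:
  assumes "prob_space M" and X: "X \<in> borel_measurable M"
    and s: "\<P>(\<omega> in M. S \<omega> = s) > 0" and A: "A \<in> sets borel"
  shows "measure (cond_law M X S s) A = \<P>(\<omega> in M. X \<omega> \<in> A \<bar> S \<omega> = s)"
proof -
  interpret prob_space M by fact
  have "measure (cond_law M X S s) A =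
      measure (uniform_measure M {\<omega> \<in> space M. S \<omega> = s}) (X -` A \<inter> space M)"
    unfolding cond_law_def using X A by (subst measure_distr) auto
  \<comment> \<open>The event \<open>S = s\<close> is measurable because its probability is
    positive: sets outside the sigma-algebra have measure 0.\<close>
  also have "\<dots> = measure M ({\<omega> \<in> space M. S \<omega> = s} \<inter> (X -` A \<inter> space M)) / \<P>(\<omega> in M. S \<omega> = s)"
    using s X A by (intro measure_uniform_measure) (auto simp: emeasure_eq_measure)
  also have "{\<omega> \<in> space M. S \<omega> = s} \<inter> (X -` A \<inter> space M) = {\<omega> \<in> space M. X \<omega> \<in> A \<and> S \<omega> = s}"
    by auto
  finally show ?thesis by (simp add: cond_prob_def)
qed

text \<open>This makes the law of \<open>X\<close> a single dominating measure for both conditional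
  laws.\<close>

lemma cond_law_absolutely_continuous:
  assumes "X \<in> borel_measurable M" "{\<omega> \<in> space M. S \<omega> = s} \<in> sets M"
  shows "absolutely_continuous (distr M borel X) (cond_law M X S s)"
proof -
  have "N \<in> null_sets (cond_law M X S s)" if "N \<in> null_sets (distr M borel X)" for N
  proof -
    have N: "N \<in> sets borel" "X -` N \<inter> space M \<in> null_sets M"
      using that assms(1) by (auto simp: null_sets_distr_iff)
    \<comment> \<open>This is the numerator of the conditional probability of
      \<open>X \<in> N\<close>, so its vanishing suffices.\<close>
    have "emeasure M ({\<omega> \<in> space M. S \<omega> = s} \<inter> (X -` N \<inter> space M)) = 0"
      using N(2) assms(2) by (metis null_setsD1 null_set_Int1 Int_commute)
    then show ?thesis
      using N assms unfolding cond_law_def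
      by (auto simp: null_sets_def emeasure_distr)
  qed
  then show ?thesis by (auto simp: absolutely_continuous_def)
qed

text \<open>Taking the complement of \<open>g = 1\<close> under the law given \<open>S = 0\<close>
  expresses both error terms through the one set \<open>B\<close>.\<close>

lemma BER_eq_cond_law:
  assumes M: "prob_space M" and X: "X \<in> borel_measurable M"
    and S0: "\<P>(\<omega> in M. S \<omega> = 0) > 0" and S1: "\<P>(\<omega> in M. S \<omega> = 1) > 0"
    and g: "g \<in> binary_classifiers"
  defines "B \<equiv> {x. g x = 0}"
  shows "B \<in> sets borel"
    and "BER M g X S = 1/2 * (1 - (measure (cond_law M X S 0) B - measure (cond_law M X S 1) B))"
proof -
  have gm: "g \<in> borel \<rightarrow>\<^sub>M count_space {0, 1}"
    using g by (simp add: binary_classifiers_def)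
  have "g -` {0} \<inter> space borel \<in> sets borel"
    using gm by (rule measurable_sets) simp
  then show B: "B \<in> sets borel" by (simp add: B_def vimage_def)
  \<comment> \<open>Measurability into \<open>count_space {0, 1}\<close> rules out all values other
    than 0 and 1.\<close>
  have one: "g x = 1 \<longleftrightarrow> x \<in> - B" for x
    using measurable_space[OF gm, of x] by (auto simp: B_def)
  interpret P: prob_space "cond_law M X S 0" by (rule prob_space_cond_law[OF M X S0])
  have "\<P>(\<omega> in M. g (X \<omega>) = 1 \<bar> S \<omega> = 0) = measure (cond_law M X S 0) (- B)"
    unfolding one using B by (subst measure_cond_law[OF M X S0]) auto
  also have "\<dots> = 1 - measure (cond_law M X S 0) B"
    using P.prob_compl[of B] B by (simp add: cond_law_def Compl_eq_Diff_UNIV)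
  finally have "\<P>(\<omega> in M. g (X \<omega>) = 1 \<bar> S \<omega> = 0) = 1 - measure (cond_law M X S 0) B" .
  moreover have "\<P>(\<omega> in M. g (X \<omega>) = 0 \<bar> S \<omega> = 1) = measure (cond_law M X S 1) B"
    using measure_cond_law[OF M X S1 B] by (simp add: B_def)
  ultimately show "BER M g X S =
      1/2 * (1 - (measure (cond_law M X S 0) B - measure (cond_law M X S 1) B))"
    by (simp add: BER_def)
qed

theorem theorem2p2:
  fixes M :: "'w measure" and X :: "'w \<Rightarrow> real ^ 'd" and S :: "'w \<Rightarrow> nat"
  assumes "prob_space M"
    and "X \<in> borel_measurable M"
    and "S \<in> M \<rightarrow>\<^sub>M count_space {0, 1}"
    and "\<P>(\<omega> in M. S \<omega> = 0) > 0"
    and "\<P>(\<omega> in M. S \<omega> = 1) > 0"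
  shows "(\<exists>g\<in>binary_classifiers.
            BER M g X S = 1/2 * (1 - tv_dist (cond_law M X S 0) (cond_law M X S 1))) \<and>
         (\<forall>g\<in>binary_classifiers.
            1/2 * (1 - tv_dist (cond_law M X S 0) (cond_law M X S 1)) \<le> BER M g X S)"
proof -
  let ?P = "cond_law M X S 0" and ?Q = "cond_law M X S 1" and ?\<mu> = "distr M borel X"
  note ber = BER_eq_cond_law[OF assms(1,2,4,5)]
  have P: "prob_space ?P" and Q: "prob_space ?Q"
    using assms by (auto intro: prob_space_cond_law)
  have meas: "{\<omega> \<in> space M. S \<omega> = s} \<in> sets M" if "s \<in> {0, 1}" for s
    using measurable_sets[OF assms(3), of "{s}"] that
    by (simp add: vimage_def Int_def conj_commute)
  have "sigma_finite_measure ?\<mu>"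
    using prob_space.prob_space_distr[OF assms(1,2)]
    by (intro finite_measure.sigma_finite_measure prob_space.finite_measure)
  then obtain f\<^sub>0 f\<^sub>1 where cd: "common_densities ?P ?Q ?\<mu> f\<^sub>0 f\<^sub>1"
    using common_densities_exist[OF _ P Q] cond_law_absolutely_continuous[OF assms(2) meas]
    by force
  note tv = tv_dist_maximum[OF P Q _ cd, simplified]
  obtain B where B: "B \<in> sets borel" "measure ?P B - measure ?Q B = tv_dist ?P ?Q"
    using tv(1) by auto
  \<comment> \<open>Label 0 is predicted exactly on the maximising set, so the two conditional laws
    differ by the full distance on \<open>{g = 0}\<close>.\<close>
  define g :: "real ^ 'd \<Rightarrow> nat" where "g = (\<lambda>x. if x \<in> B then 0 else 1)"
  have g: "g \<in> binary_classifiers"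
    unfolding binary_classifiers_def g_def using B(1) by (intro measurable_If_set) auto
  have "{x. g x = 0} = B" by (auto simp: g_def)
  then have "BER M g X S = 1/2 * (1 - tv_dist ?P ?Q)"
    using ber(2)[OF g] B(2) by simp
  \<comment> \<open>The error decreases in the difference of the two laws on \<open>{h = 0}\<close>,
    and that difference is at most the distance.\<close>
  moreover have "1/2 * (1 - tv_dist ?P ?Q) \<le> BER M h X S" if "h \<in> binary_classifiers" for h
    using tv(2)[OF ber(1)[OF that]] unfolding ber(2)[OF that] by simp
  ultimately show ?thesis using g by blast
qed

end
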